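(* Let $k_1,k_2\ge 1$ be integers and let $x=\{x_1,x_2,\ldots\}$ be a sequence of real numbers. (i) If $y_n=\hat{B}_{n,k_1}(x)$ for all $n\ge 1$, then for all $n\ge 1$ $$\hat{B}_{n,k_1k_2}(x)=\hat{B}_{n,k_2}(y).$$ (ii) If $y_n=B_{n,k_1}(x)$ for all $n\ge 1$, then for all $n\ge 1$ $$B_{n,k_1k_2}(x)=\frac{(k_1!)^{k_2}\,k_2!}{(k_1k_2)!}\,B_{n,k_2}(y).$$
   Context: For a real sequence $x=\{x_1,x_2,\ldots\}$ the partial exponential Bell polynomials are $$B_{n,k}(x)=\sum \frac{n!}{j_1!\,j_2!\cdots j_n!}\left(\frac{x_1}{1!}\right)^{j_1}\left(\frac{x_2}{2!}\right)^{j_2}\cdots\left(\frac{x_n}{n!}\right)^{j_n},$$ the sum being over all $n$-tuples of nonnegative integers $(j_1,\ldots,j_n)$ with $j_1+j_2+\cdots+j_n=k$ and $j_1+2j_2+\cdots+nj_n=n$. Conventions: $B_{0,0}(x)=1$, and $B_{n,0}(x)=B_{0,k}(x)=0$ for $n,k\ge 1$; $B_{n,k}(x)=0$ for $n<k$. The partial ordinary Bell polynomials are $\hat{B}_{n,k}(x)=\frac{k!}{n!}B_{n,k}(\tilde x)$, where $\tilde x_m=m!\,x_m$. Equivalently, as formal power series, $\left(\sum_{j\ge 1}x_jz^j\right)^k=\sum_{n\ge k}\hat{B}_{n,k}(x)z^n$. *)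

theory Defs
  imports Complex_Main "HOL-Library.FuncSet"
begin

text \<open>
  A sequence \<open>x\<^sub>1, x\<^sub>2, \<dots>\<close> is a function \<open>x :: nat \<Rightarrow> real\<close> whose value at index 0 is
  never used. An \<open>n\<close>-tuple \<open>(j\<^sub>1, \<dots>, j\<^sub>n)\<close> is an extensional function on \<open>{1..n}\<close>, so that each
  tuple is counted exactly once.
\<close>

definition bell_tuples :: "nat \<Rightarrow> nat \<Rightarrow> (nat \<Rightarrow> nat) set" where
  "bell_tuples n k =
     {j \<in> {1..n} \<rightarrow>\<^sub>E UNIV. (\<Sum>i=1..n. j i) = k \<and> (\<Sum>i=1..n. i * j i) = n}"

definition bell :: "nat \<Rightarrow> nat \<Rightarrow> (nat \<Rightarrow> real) \<Rightarrow> real" where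
  "bell n k x =
     (\<Sum>j\<in>bell_tuples n k.
        fact n / (\<Prod>i=1..n. fact (j i)) * (\<Prod>i=1..n. (x i / fact i) ^ j i))"

definition ordinary_bell :: "nat \<Rightarrow> nat \<Rightarrow> (nat \<Rightarrow> real) \<Rightarrow> real" where
  "ordinary_bell n k x = fact k / fact n * bell n k (\<lambda>m. fact m * x m)"

text \<open>The sum defining \<^const>\<open>bell\<close> is finite, and the usual boundary conventions hold.\<close>

lemma finite_bell_tuples: "finite (bell_tuples n k)"
proof (rule finite_subset)
  show "bell_tuples n k \<subseteq> {1..n} \<rightarrow>\<^sub>E {..k}"
  proof
    fix j assume j: "j \<in> bell_tuples n k"
    have "j i \<le> k" if "i \<in> {1..n}" for i
      using j member_le_sum[of i "{1..n}" j] that by (auto simp: bell_tuples_def)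
    with j show "j \<in> {1..n} \<rightarrow>\<^sub>E {..k}"
      by (auto simp: bell_tuples_def PiE_iff)
  qed
qed (simp add: finite_PiE)

lemma bell_0_0: "bell 0 0 x = 1"
  by (simp add: bell_def bell_tuples_def)

lemma bell_n_0: "n \<ge> 1 \<Longrightarrow> bell n 0 x = 0"
proof -
  assume "n \<ge> 1"
  then have "bell_tuples n 0 = {}"
    by (auto simp: bell_tuples_def)
  then show ?thesis by (simp add: bell_def)
qed

lemma bell_less:
  assumes "n < k"
  shows "bell n k x = 0"
proof -
  have "j \<notin> bell_tuples n k" for j
  proof
    assume j: "j \<in> bell_tuples n k"
    have "(\<Sum>i=1..n. j i) \<le> (\<Sum>i=1..n. i * j i)"
      by (rule sum_mono) auto
    with j assms show False by (simp add: bell_tuples_def)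
  qed
  then have "bell_tuples n k = {}" by blast
  then show ?thesis by (simp add: bell_def)
qed

end

(* By the multinomial theorem, k! / n! B_{n,k}(x) is the n-th coefficient of g^k, where g is the
   exponential generating function of x without constant term. Both identities are the law
   (g^{k_1})^{k_2} = g^{k_1 k_2}, as the generating function of y is g^{k_1} up to a constant;
   its constant term vanishes because k_1 >= 1. *)

theory Submission
  imports Defs "HOL-Computational_Algebra.Formal_Power_Series"
begin

unbundle fps_syntax

text \<open>The binomial theorem for divided powers \<open>f ^ k / k!\<close>: since
  \<open>k choose r\<close> is \<open>k! / (r! (k - r)!)\<close>, dividing by \<open>k!\<close>
  leaves a plain convolution, which is easy to iterate.\<close>

lemma divided_power_add:
  fixes f g :: "'a :: field_char_0 fps"
  shows "fps_const (1 / fact k) * (f + g) ^ k =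
    (\<Sum>r\<le>k. (fps_const (1 / fact r) * f ^ r) * (fps_const (1 / fact (k - r)) * g ^ (k - r)))"
proof -
  have "fps_const (1 / fact k) * (of_nat (k choose r) * f ^ r * g ^ (k - r)) =
      (fps_const (1 / fact r) * f ^ r) * (fps_const (1 / fact (k - r)) * g ^ (k - r))"
    if "r \<le> k" for r
  proof -
    have "1 / fact k * of_nat (k choose r) = (1 / fact r * (1 / fact (k - r)) :: 'a)"
      using that by (simp add: binomial_fact)
    then have "fps_const (1 / fact k) * of_nat (k choose r) =
        fps_const (1 / fact r) * fps_const (1 / fact (k - r) :: 'a)"
      by (simp add: fps_of_nat [symmetric])
    then show ?thesis
      by (metis (no_types, lifting) mult.assoc mult.left_commute)
  qed
  then show ?thesis
    unfolding binomial_ring sum_distrib_left by (intro sum.cong) auto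
qed

lemma finite_PiE_sum_eq:
  fixes k :: nat
  assumes "finite A"
  shows "finite {j \<in> A \<rightarrow>\<^sub>E UNIV. sum j A = k}"
proof (rule finite_subset)
  show "{j \<in> A \<rightarrow>\<^sub>E UNIV. sum j A = k} \<subseteq> A \<rightarrow>\<^sub>E {..k}"
    using assms by (auto simp: PiE_iff extensional_def intro: member_le_sum)
qed (use assms in \<open>simp add: finite_PiE\<close>)

text \<open>The multinomial theorem for divided powers, by splitting off one summand at a time with
  \<open>divided_power_add\<close>. The exponent tuples are extensional functions so that they match
  \<open>bell_tuples\<close>.\<close>

lemma divided_power_sum:
  fixes f :: "'i \<Rightarrow> 'a :: field_char_0 fps"
  assumes "finite A"
  shows "fps_const (1 / fact k) * (\<Sum>i\<in>A. f i) ^ k =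
    (\<Sum>j\<in>{j \<in> A \<rightarrow>\<^sub>E UNIV. sum j A = k}. \<Prod>i\<in>A. fps_const (1 / fact (j i)) * f i ^ j i)"
  using assms
proof (induction A arbitrary: k rule: finite_induct)
  case empty
  \<comment> \<open>The empty tuple is the only one, and its entries sum to 0. So the right-hand
    side is 1 for \<open>k = 0\<close> and 0 otherwise, like the power of the empty sum.\<close>
  have "{j. j = (\<lambda>x. undefined) \<and> 0 = k} = (if k = 0 then {\<lambda>x. undefined} else {})"
    for k by auto
  then show ?case
    by (simp add: power_0_left)
next
  case (insert a A)
  define T where "T B k = {j \<in> B \<rightarrow>\<^sub>E (UNIV :: nat set). sum j B = k}" for B :: "'i set" and k
  define D where "D i r = fps_const (1 / fact r) * f i ^ r" for i r
  have sum_upd: "sum (j(a := r)) A = sum j A" for j :: "'i \<Rightarrow> nat" and r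
    using insert.hyps by (intro sum.cong) auto
  have prod_upd: "(\<Prod>i\<in>A. D i ((j(a := r)) i)) = (\<Prod>i\<in>A. D i (j i))" for j r
    using insert.hyps by (intro prod.cong) auto
  have finT: "finite (T A m)" for m
    unfolding T_def using insert.hyps by (intro finite_PiE_sum_eq)
  have "fps_const (1 / fact k) * (\<Sum>i\<in>insert a A. f i) ^ k =
      (\<Sum>r\<le>k. D a r * (\<Sum>j\<in>T A (k - r). \<Prod>i\<in>A. D i (j i)))"
    using insert by (simp add: divided_power_add T_def D_def)
  also have "\<dots> = (\<Sum>(r, j)\<in>(SIGMA r:{..k}. T A (k - r)). D a r * (\<Prod>i\<in>A. D i (j i)))"
    by (simp add: sum_distrib_left sum.Sigma finT)
  \<comment> \<open>A tuple on \<open>insert a A\<close> amounts to its entry \<open>r\<close> at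
    \<open>a\<close> together with its restriction to \<open>A\<close>; resetting \<open>a\<close>
    to \<open>undefined\<close> keeps the restriction extensional.\<close>
  also have "\<dots> = (\<Sum>j\<in>T (insert a A) k. \<Prod>i\<in>insert a A. D i (j i))"
  proof (rule sum.reindex_bij_witness
      [where i = "\<lambda>j. (j a, j(a := undefined))" and j = "\<lambda>(r, j). j(a := r)"], goal_cases)
    case (1 p)
    then show ?case
      using insert.hyps by (auto simp: T_def PiE_iff extensional_def fun_eq_iff)
  next
    case (2 p)
    then show ?case
      using insert.hyps
      by (auto simp: T_def PiE_iff extensional_def sum_upd simp del: fun_upd_apply) auto
  next
    case (3 j)
    then show ?case by simp
  next
    case (4 j)
    then show ?case
      using insert.hyps
      by (auto simp: T_def PiE_iff extensional_def sum_upd simp del: fun_upd_apply) auto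
  next
    case (5 p)
    obtain r j where "p = (r, j)" by force
    then show ?case
      using insert.hyps prod_upd[of j r] by simp
  qed
  finally show ?case
    by (simp add: T_def D_def)
qed

text \<open>Multiplication never lowers degrees, so terms beyond degree \<open>n\<close> cannot
  affect coefficient \<open>n\<close>. This allows \<open>gf x\<close> to be truncated to a finite
  sum.\<close>

lemma fps_power_nth_cong:
  fixes f g :: "'a :: comm_semiring_1 fps"
  assumes "\<And>i. i \<le> n \<Longrightarrow> f $ i = g $ i"
  shows "f ^ k $ n = g ^ k $ n"
  using assms
proof (induction k arbitrary: n)
  case (Suc k)
  have "f ^ k $ i = g ^ k $ i" if "i \<le> n" for i
    using that by (intro Suc.IH) (simp add: Suc.prems)
  then show ?case
    by (simp add: fps_mult_nth Suc.prems)
qed simp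

text \<open>The index 0 is masked because Bell polynomials ignore the value of the sequence there.\<close>

definition gf :: "(nat \<Rightarrow> real) \<Rightarrow> real fps" where
  "gf x = Abs_fps (\<lambda>i. if i = 0 then 0 else x i)"

text \<open>In the multinomial expansion of the truncated series, the tuple \<open>j\<close> yields
  a monomial of degree \<open>\<Sum>i=1..n. i * j i\<close>. Extracting coefficient \<open>n\<close>
  keeps exactly the tuples of weight \<open>n\<close>, which form
  \<open>bell_tuples n k\<close>.\<close>

lemma gf_power_nth:
  "gf x ^ k $ n = fact k *
     (\<Sum>j\<in>bell_tuples n k. 1 / (\<Prod>i=1..n. fact (j i)) * (\<Prod>i=1..n. x i ^ j i))"
proof -
  define f where "f i = fps_const (x i) * fps_X ^ i" for i
  define T where "T = {j \<in> {1..n} \<rightarrow>\<^sub>E UNIV. sum j {1..n} = k}"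
  have tuples: "bell_tuples n k = {j \<in> T. n = (\<Sum>i=1..n. i * j i)}"
    by (auto simp: bell_tuples_def T_def)
  have finT: "finite T"
    unfolding T_def by (intro finite_PiE_sum_eq) simp
  have term_nth: "(\<Prod>i=1..n. fps_const (1 / fact (j i)) * f i ^ j i) $ n =
      (if n = (\<Sum>i=1..n. i * j i)
       then 1 / (\<Prod>i=1..n. fact (j i)) * (\<Prod>i=1..n. x i ^ j i) else 0)" for j
  proof -
    have const: "(\<Prod>i\<in>A. fps_const (c i)) = fps_const (\<Prod>i\<in>A. c i)"
      for A :: "nat set" and c :: "nat \<Rightarrow> real"
      by (induction A rule: infinite_finite_induct) auto
    have "(\<Prod>i=1..n. fps_const (1 / fact (j i)) * f i ^ j i) =
        (\<Prod>i=1..n. fps_const (1 / fact (j i) * x i ^ j i) * fps_X ^ (i * j i))"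
      by (simp add: f_def power_mult_distrib power_mult fps_const_power
          flip: mult.assoc)
    also have "\<dots> = fps_const (\<Prod>i=1..n. 1 / fact (j i) * x i ^ j i) * fps_X ^ (\<Sum>i=1..n. i * j i)"
      by (simp only: prod.distrib const power_sum)
    finally show ?thesis
      by (simp add: prod.distrib prod_dividef)
  qed
  have "gf x ^ k $ n = (\<Sum>i=1..n. f i) ^ k $ n"
    by (rule fps_power_nth_cong) (auto simp: gf_def f_def fps_sum_nth mult_delta_right)
  also have "\<dots> = fact k * (fps_const (1 / fact k) * (\<Sum>i=1..n. f i) ^ k) $ n"
    by simp
  also have "\<dots> = fact k * (\<Sum>j\<in>T. (\<Prod>i=1..n. fps_const (1 / fact (j i)) * f i ^ j i) $ n)"
    unfolding T_def by (subst divided_power_sum) (simp_all add: fps_sum_nth)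
  also have "\<dots> = fact k *
     (\<Sum>j\<in>bell_tuples n k. 1 / (\<Prod>i=1..n. fact (j i)) * (\<Prod>i=1..n. x i ^ j i))"
    unfolding term_nth tuples by (subst sum.inter_filter [OF finT]) simp
  finally show ?thesis .
qed

lemma bell_eq_gf: "bell n k x = fact n / fact k * gf (\<lambda>i. x i / fact i) ^ k $ n"
  unfolding gf_power_nth bell_def by (simp add: sum_distrib_left)

text \<open>The weights \<open>fact m\<close> in \<open>ordinary_bell\<close> cancel the division by
  \<open>fact i\<close> in \<open>bell_eq_gf\<close>, and the outer factorials cancel as
  well.\<close>

lemma ordinary_bell_eq_gf: "ordinary_bell n k x = gf x ^ k $ n"
  by (simp add: ordinary_bell_def bell_eq_gf)

lemma gf_eq_iff: "gf y = F \<longleftrightarrow> F $ 0 = 0 \<and> (\<forall>n\<ge>1. y n = F $ n)"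
  by (auto simp: gf_def fps_eq_iff)

lemma gf_power_nth_0: "k \<ge> 1 \<Longrightarrow> gf x ^ k $ 0 = 0"
  by (simp add: gf_def fps_nth_power_0)

theorem theorem1:
  fixes k\<^sub>1 k\<^sub>2 :: nat and x :: "nat \<Rightarrow> real"
  assumes "k\<^sub>1 \<ge> 1" and "k\<^sub>2 \<ge> 1"
  shows "(\<forall>y :: nat \<Rightarrow> real. (\<forall>n\<ge>1. y n = ordinary_bell n k\<^sub>1 x) \<longrightarrow>
            (\<forall>n\<ge>1. ordinary_bell n (k\<^sub>1 * k\<^sub>2) x = ordinary_bell n k\<^sub>2 y)) \<and>
         (\<forall>y :: nat \<Rightarrow> real. (\<forall>n\<ge>1. y n = bell n k\<^sub>1 x) \<longrightarrow>
            (\<forall>n\<ge>1. bell n (k\<^sub>1 * k\<^sub>2) x =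
              (fact k\<^sub>1) ^ k\<^sub>2 * fact k\<^sub>2 / fact (k\<^sub>1 * k\<^sub>2) * bell n k\<^sub>2 y))"
proof (intro conjI allI impI)
  fix y :: "nat \<Rightarrow> real" and n :: nat
  assume "\<forall>n\<ge>1. y n = ordinary_bell n k\<^sub>1 x"
  then have "gf y = gf x ^ k\<^sub>1"
    using assms by (simp add: gf_eq_iff gf_power_nth_0 ordinary_bell_eq_gf)
  then show "ordinary_bell n (k\<^sub>1 * k\<^sub>2) x = ordinary_bell n k\<^sub>2 y"
    by (simp add: ordinary_bell_eq_gf power_mult)
next
  fix y :: "nat \<Rightarrow> real" and n :: nat
  assume "\<forall>n\<ge>1. y n = bell n k\<^sub>1 x"
  \<comment> \<open>Dividing \<open>y i\<close> by \<open>fact i\<close> removes the factor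
    \<open>fact n\<close> of \<open>bell_eq_gf\<close>; its denominator
    \<open>fact k\<^sub>1\<close> remains as a constant.\<close>
  then have "gf (\<lambda>i. y i / fact i) = fps_const (1 / fact k\<^sub>1) * gf (\<lambda>i. x i / fact i) ^ k\<^sub>1"
    using assms by (simp add: gf_eq_iff gf_power_nth_0 bell_eq_gf)
  \<comment> \<open>This constant, raised to the power \<open>k\<^sub>2\<close>, gives the factor
    \<open>(fact k\<^sub>1) ^ k\<^sub>2\<close> of the claim; the other two factorials come from
    \<open>bell_eq_gf\<close> for \<open>k\<^sub>2\<close> and
    \<open>k\<^sub>1 * k\<^sub>2\<close>.\<close>
  then have "gf (\<lambda>i. y i / fact i) ^ k\<^sub>2 =
      fps_const (1 / fact k\<^sub>1 ^ k\<^sub>2) * gf (\<lambda>i. x i / fact i) ^ (k\<^sub>1 * k\<^sub>2)"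
    by (simp add: power_mult_distrib power_mult fps_const_power power_one_over)
  then show "bell n (k\<^sub>1 * k\<^sub>2) x =
      (fact k\<^sub>1) ^ k\<^sub>2 * fact k\<^sub>2 / fact (k\<^sub>1 * k\<^sub>2) * bell n k\<^sub>2 y"
    by (simp add: bell_eq_gf)
qed

end
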